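(* Let $\mathbb{K}$ be a field, $R=\mathbb{K}[X_1,\ldots,X_n]$, and let $I\subset R$ be a monomial ideal with primary decomposition $I=\bigcap_{i=1}^r Q_i$, where each $Q_i$ is a primary monomial ideal. Then $I^{[m]}=\bigcap_{i=1}^r Q_i^{[m]}$ is a primary decomposition of $I^{[m]}$ for all integers $m\ge 2$. Moreover, $\operatorname{Ass}(I)=\operatorname{Ass}(I^{[m]})$ and $\operatorname{Min}(I)=\operatorname{Min}(I^{[m]})$ for all $m\ge 2$.
   Context: For $f\in R$ and a positive integer $m$, $f^{[m]}:=f(X_1^m,\ldots,X_n^m)$, and the $m$-th square power of an ideal $I\subset R$ is the ideal $I^{[m]}:=\langle f^{[m]} : f\in I\rangle$ of $R$. $\operatorname{Ass}(I)$ denotes the set of associated primes of the $R$-module $R/I$, and $\operatorname{Min}(I)$ the set of minimal primes of $I$. *)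

theory Defs
  imports "HOL-Algebra.Algebraic_Closure_Type" "HOL-Library.Poly_Mapping"
begin

section \<open>Primary ideals, associated primes and minimal primes\<close>

locale primary_ideal = ideal + cring +
  assumes I_notcarr: "carrier R \<noteq> I"
    and I_primary: "\<lbrakk>a \<in> carrier R; b \<in> carrier R; a \<otimes> b \<in> I\<rbrakk>
      \<Longrightarrow> a \<in> I \<or> (\<exists>k::nat. k > 0 \<and> b [^] k \<in> I)"

text \<open>Intersecting with the carrier makes the empty intersection (\<open>r = 0\<close>) the unit ideal. The
  decomposition is not required to be irredundant.\<close>

definition primary_decomposition ::
    "('a, 'b) ring_scheme \<Rightarrow> 'a set \<Rightarrow> nat \<Rightarrow> (nat \<Rightarrow> 'a set) \<Rightarrow> bool"
  where "primary_decomposition R I r Q \<longleftrightarrow>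
    (\<forall>i\<in>{1..r}. primary_ideal (Q i) R) \<and> I = carrier R \<inter> (\<Inter>i\<in>{1..r}. Q i)"

definition annihilator ::
    "('a, 'c) ring_scheme \<Rightarrow> ('a, 'b, 'd) module_scheme \<Rightarrow> 'b \<Rightarrow> 'a set"
  where "annihilator R M x = {a \<in> carrier R. a \<odot>\<^bsub>M\<^esub> x = \<zero>\<^bsub>M\<^esub>}"

definition associated_primes ::
    "('a, 'c) ring_scheme \<Rightarrow> ('a, 'b, 'd) module_scheme \<Rightarrow> 'a set set"
  where "associated_primes R M =
    {P. primeideal P R \<and> (\<exists>x\<in>carrier M. P = annihilator R M x)}"

text \<open>The quotient ring \<open>R / I\<close> as an \<open>R\<close>-module.\<close>

definition quotient_module :: "('a, 'b) ring_scheme \<Rightarrow> 'a set \<Rightarrow> ('a, 'a set) module"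
  where "quotient_module R I =
    ring.extend (R Quot I)
      (module.fields (\<lambda>a x. (I +>\<^bsub>R\<^esub> a) \<otimes>\<^bsub>R Quot I\<^esub> x))"

definition Ass :: "('a, 'b) ring_scheme \<Rightarrow> 'a set \<Rightarrow> 'a set set"
  where "Ass R I = associated_primes R (quotient_module R I)"

definition Min_primes :: "('a, 'b) ring_scheme \<Rightarrow> 'a set \<Rightarrow> 'a set set"
  where "Min_primes R I =
    {P. primeideal P R \<and> I \<subseteq> P \<and> (\<forall>P'. primeideal P' R \<longrightarrow> I \<subseteq> P' \<longrightarrow> P' \<subseteq> P \<longrightarrow> P' = P)}"


section \<open>Polynomials in finitely many variables\<close>

text \<open>The variables are indexed by a finite type \<open>'n\<close>; their number \<open>n\<close> is \<open>CARD('n)\<close>.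
  An exponent vector is of type \<open>'n \<Rightarrow>\<^sub>0 nat\<close>, and the product of the type of finitely supported
  coefficient families is the convolution product.\<close>

type_synonym ('n, 'k) mpoly = "('n \<Rightarrow>\<^sub>0 nat) \<Rightarrow>\<^sub>0 'k"

abbreviation mpoly_ring :: "('n::finite, 'k::field) mpoly ring"
  where "mpoly_ring \<equiv> ring_of_type_algebra"

definition indet :: "'n::finite \<Rightarrow> ('n, 'k::field) mpoly"
  where "indet i = Poly_Mapping.single (Poly_Mapping.single i 1) 1"

definition monomial :: "('n::finite \<Rightarrow>\<^sub>0 nat) \<Rightarrow> ('n, 'k::field) mpoly"
  where "monomial t = Poly_Mapping.single t 1"

definition monomial_ideal :: "('n::finite, 'k::field) mpoly set \<Rightarrow> bool"
  where "monomial_ideal I \<longleftrightarrow> (\<exists>T. I = Idl\<^bsub>mpoly_ring\<^esub> (monomial ` T))"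

text \<open>\<open>substitute g f\<close> is \<open>f(g\<^sub>1, \<dots>, g\<^sub>n)\<close>.\<close>

definition substitute ::
    "('n::finite \<Rightarrow> ('n, 'k::field) mpoly) \<Rightarrow> ('n, 'k) mpoly \<Rightarrow> ('n, 'k) mpoly"
  where "substitute g f =
    (\<Sum>t\<in>Poly_Mapping.keys f. Poly_Mapping.single 0 (Poly_Mapping.lookup f t) *
      (\<Prod>i\<in>UNIV. g i ^ Poly_Mapping.lookup t i))"

definition square_power_poly :: "('n::finite, 'k::field) mpoly \<Rightarrow> nat \<Rightarrow> ('n, 'k) mpoly"
  where "square_power_poly f m = substitute (\<lambda>i. indet i ^ m) f"

definition square_power :: "('n::finite, 'k::field) mpoly set \<Rightarrow> nat \<Rightarrow> ('n, 'k) mpoly set"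
  where "square_power I m = Idl\<^bsub>mpoly_ring\<^esub> {square_power_poly f m | f. f \<in> I}"

end

theory Submission
  imports Defs
begin

text \<open>
  A monomial ideal is the span of an up-closed set \<open>U\<close> of exponents, and its \<open>m\<close>-th square power is
  the span of \<open>{t. \<lfloor>t / m\<rfloor> \<in> U}\<close>; hence square powers commute with intersections. A monomial ideal is
  primary iff each variable either has a power in it or is a non-zero-divisor modulo it, which is a
  condition on exponents stable under \<open>U \<mapsto> {t. \<lfloor>t / m\<rfloor> \<in> U}\<close>. Using the primary decomposition, every
  associated prime \<open>I : f\<close> is generated by a set \<open>V\<close> of variables and equals \<open>I : X\<^sup>t\<close> for a monomial
  \<open>X\<^sup>t\<close> of \<open>f\<close>; the witnesses \<open>t\<close> for \<open>I\<close> and \<open>I\<^bsup>[m]\<^esup>\<close> are translated into each other by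
  \<open>t \<mapsto> m t + (m - 1) 1\<^sub>V\<close> and \<open>t \<mapsto> \<lfloor>t / m\<rfloor>\<close>. A prime contains \<open>I\<close> iff it contains \<open>I\<^bsup>[m]\<^esup>\<close>, so the
  minimal primes agree.
\<close>

section \<open>Ideals of type-class rings\<close>

lemma ring_of_type_algebra_simps [simp]:
  "carrier ring_of_type_algebra = UNIV"
  "x \<otimes>\<^bsub>ring_of_type_algebra\<^esub> y = x * y"
  "x \<oplus>\<^bsub>ring_of_type_algebra\<^esub> y = x + y"
  "\<one>\<^bsub>ring_of_type_algebra\<^esub> = 1"
  "\<zero>\<^bsub>ring_of_type_algebra\<^esub> = 0"
  by (simp_all add: ring_of_type_algebra_def)

lemma nat_pow_ring_of_type_algebra [simp]:
  fixes x :: "'a::comm_ring_1"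
  shows "x [^]\<^bsub>ring_of_type_algebra\<^esub> (k::nat) = x ^ k"
proof -
  interpret cring "ring_of_type_algebra :: 'a ring" ..
  show ?thesis by (induction k) (simp_all add: mult.commute)
qed

lemma ideal_ring_of_type_algebra_iff:
  fixes I :: "'a::comm_ring_1 set"
  shows "ideal I ring_of_type_algebra \<longleftrightarrow>
    0 \<in> I \<and> (\<forall>a\<in>I. \<forall>b\<in>I. a + b \<in> I) \<and> (\<forall>a\<in>I. \<forall>x. x * a \<in> I)" (is "_ \<longleftrightarrow> ?closed")
proof
  assume "ideal I ring_of_type_algebra"
  then interpret I: ideal I "ring_of_type_algebra :: 'a ring" .
  show ?closed
    using additive_subgroup.zero_closed[OF I.additive_subgroup_axioms]
      additive_subgroup.a_closed[OF I.additive_subgroup_axioms] I.I_l_closed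
    by simp
next
  assume closed: ?closed
  interpret cring "ring_of_type_algebra :: 'a ring" ..
  have neg: "- a \<in> I" if "a \<in> I" for a
    using closed that by (metis mult_minus1)
  \<comment> \<open>The subgroup axioms use the inverse of the additive monoid record, which must be
    identified with unary minus.\<close>
  have "a_inv ring_of_type_algebra a = - a" for a :: 'a
    by (rule minus_equality) simp_all
  hence "m_inv (add_monoid ring_of_type_algebra) a = - a" for a :: 'a
    by (simp add: a_inv_def)
  then show "ideal I ring_of_type_algebra"
    using closed neg
    by (intro idealI subgroup.intro) (auto simp: mult.commute)
qed

lemma primeideal_ring_of_type_algebra_iff:
  fixes P :: "'a::comm_ring_1 set"
  shows "primeideal P ring_of_type_algebra \<longleftrightarrow>
    ideal P ring_of_type_algebra \<and> P \<noteq> UNIV \<and> (\<forall>a b. a * b \<in> P \<longrightarrow> a \<in> P \<or> b \<in> P)"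
  using cring_from_type_algebra
  by (auto simp: primeideal_def primeideal_axioms_def)

lemma primary_ideal_ring_of_type_algebra_iff:
  fixes Q :: "'a::comm_ring_1 set"
  shows "primary_ideal Q ring_of_type_algebra \<longleftrightarrow>
    ideal Q ring_of_type_algebra \<and> Q \<noteq> UNIV \<and>
    (\<forall>a b. a * b \<in> Q \<longrightarrow> a \<in> Q \<or> (\<exists>k>0. b ^ k \<in> Q))"
  using cring_from_type_algebra
  by (auto simp: primary_ideal_def primary_ideal_axioms_def)

lemma prod_mem_primeideal:
  fixes P :: "'a::comm_ring_1 set"
  assumes "primeideal P ring_of_type_algebra" "finite A" "(\<Prod>x\<in>A. f x) \<in> P"
  shows "\<exists>x\<in>A. f x \<in> P"
  using assms(2,3)
proof (induction A rule: finite_induct)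
  \<comment> \<open>The empty product is 1, which a proper ideal cannot contain.\<close>
  case empty
  then show ?case
    using assms(1) unfolding primeideal_ring_of_type_algebra_iff ideal_ring_of_type_algebra_iff
    by (metis UNIV_eq_I mult.right_neutral prod.empty)
next
  case (insert x A)
  then show ?case
    using assms(1) unfolding primeideal_ring_of_type_algebra_iff by (metis insertCI prod.insert)
qed

lemma power_mem_primeideal:
  fixes P :: "'a::comm_ring_1 set"
  assumes "primeideal P ring_of_type_algebra" "x ^ k \<in> P"
  shows "x \<in> P"
  using prod_mem_primeideal[of P "{..<k}" "\<lambda>_. x"] assms by auto

section \<open>Associated primes as prime colon ideals\<close>

lemma
  shows carrier_quotient_module: "carrier (quotient_module R I) = a_rcosets\<^bsub>R\<^esub> I"
  and zero_quotient_module: "\<zero>\<^bsub>quotient_module R I\<^esub> = I"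
  and smult_quotient_module: "a \<odot>\<^bsub>quotient_module R I\<^esub> x = rcoset_mult R I (I +>\<^bsub>R\<^esub> a) x"
  unfolding quotient_module_def ring.defs module.defs FactRing_def by simp_all

text \<open>Every element of \<open>R / I\<close> is a coset \<open>I +> f\<close>, and its
  annihilator is the colon ideal \<open>I : f\<close>. Later arguments can thus avoid the quotient
  module.\<close>

lemma (in cring) Ass_eq:
  assumes "ideal I R"
  shows "Ass R I = {P. primeideal P R \<and> (\<exists>f\<in>carrier R. P = {a \<in> carrier R. a \<otimes> f \<in> I})}"
proof -
  interpret I: ideal I R by fact
  have coset: "I +> a = I \<longleftrightarrow> a \<in> I" if "a \<in> carrier R" for a
    using I.rcos_const_imp_mem a_rcos_zero assms that by blast
  have ann: "annihilator R (quotient_module R I) (I +> f) = {a \<in> carrier R. a \<otimes> f \<in> I}"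
    if "f \<in> carrier R" for f
  proof -
    have "(a \<odot>\<^bsub>quotient_module R I\<^esub> (I +> f) = \<zero>\<^bsub>quotient_module R I\<^esub>) \<longleftrightarrow> a \<otimes> f \<in> I"
      if "a \<in> carrier R" for a
      using that \<open>f \<in> carrier R\<close>
      by (simp add: zero_quotient_module smult_quotient_module I.rcoset_mult_add coset)
    then show ?thesis
      unfolding annihilator_def by blast
  qed
  have "a_rcosets I = (\<lambda>f. I +> f) ` carrier R"
    unfolding A_RCOSETS_def' a_r_coset_def' by blast
  then have "(\<exists>x\<in>carrier (quotient_module R I). P = annihilator R (quotient_module R I) x)
      \<longleftrightarrow> (\<exists>f\<in>carrier R. P = {a \<in> carrier R. a \<otimes> f \<in> I})" for P
    using ann by (simp add: carrier_quotient_module)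
  then show ?thesis
    unfolding Ass_def associated_primes_def by simp
qed

section \<open>Monomials\<close>

text \<open>Splitting off the term of \<open>a\<close> at \<open>u\<close> and that of
  \<open>b\<close> at \<open>s\<close> leaves remainders whose contributions to the product cannot
  reach the exponent \<open>u + s\<close>.\<close>

lemma lookup_mult_unique:
  fixes a b :: "'a::comm_monoid_add \<Rightarrow>\<^sub>0 'b::comm_ring_1"
  assumes "\<And>u' s'. u' \<in> Poly_Mapping.keys a \<Longrightarrow> s' \<in> Poly_Mapping.keys b \<Longrightarrow> u' + s' = u + s \<Longrightarrow>
    u' = u \<and> s' = s"
  shows "Poly_Mapping.lookup (a * b) (u + s) = Poly_Mapping.lookup a u * Poly_Mapping.lookup b s"
proof -
  let ?x = "Poly_Mapping.single u (Poly_Mapping.lookup a u)"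
  let ?y = "Poly_Mapping.single s (Poly_Mapping.lookup b s)"
  define a' b' where "a' = a - ?x" and "b' = b - ?y"
  have keys_a': "Poly_Mapping.keys a' \<subseteq> Poly_Mapping.keys a - {u}"
    and keys_b': "Poly_Mapping.keys b' \<subseteq> Poly_Mapping.keys b - {s}"
    by (auto simp: a'_def b'_def in_keys_iff lookup_minus lookup_single when_def split: if_splits)
  have x: "Poly_Mapping.keys ?x \<subseteq> Poly_Mapping.keys a"
    by (auto simp: in_keys_iff lookup_single when_def split: if_splits)
  have "u + s \<notin> Poly_Mapping.keys (a' * b)"
    using keys_mult[of a' b] keys_a' assms by fastforce
  moreover have "u + s \<notin> Poly_Mapping.keys (?x * b')"
    using keys_mult[of ?x b'] keys_b' x assms by fastforce
  moreover have "a * b = ?x * ?y + ?x * b' + a' * b"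
    by (simp add: a'_def b'_def algebra_simps)
  ultimately show ?thesis
    by (simp add: lookup_add mult_single in_keys_iff)
qed

lemma poly_mapping_sum_single:
  fixes f :: "'a \<Rightarrow>\<^sub>0 'b::comm_monoid_add"
  shows "f = (\<Sum>t\<in>Poly_Mapping.keys f. Poly_Mapping.single t (Poly_Mapping.lookup f t))"
  by (rule poly_mapping_eqI)
     (auto simp: lookup_sum lookup_single when_def in_keys_iff sum.delta)

lemma lookup_monomial_mult:
  fixes f :: "('n::finite, 'k::field) mpoly"
  shows "Poly_Mapping.lookup (monomial t * f) (t + s) = Poly_Mapping.lookup f s"
  using lookup_mult_unique[of "monomial t" f t s] by (simp add: monomial_def)

lemma keys_monomial_mult:
  fixes f :: "('n::finite, 'k::field) mpoly"
  shows "Poly_Mapping.keys (monomial t * f) = (+) t ` Poly_Mapping.keys f"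
proof
  show "Poly_Mapping.keys (monomial t * f) \<subseteq> (+) t ` Poly_Mapping.keys f"
    using keys_mult[of "monomial t" f] by (auto simp: monomial_def)
  show "(+) t ` Poly_Mapping.keys f \<subseteq> Poly_Mapping.keys (monomial t * f)"
    by (auto simp: in_keys_iff lookup_monomial_mult)
qed

lemma monomial_add: "monomial (s + t) = monomial s * monomial t"
  by (simp add: monomial_def mult_single)

lemma monomial_zero: "monomial 0 = 1"
  by (simp add: monomial_def)

lemma keys_monomial [simp]: "Poly_Mapping.keys (monomial t :: ('n::finite, 'k::field) mpoly) = {t}"
  by (simp add: monomial_def)

lemma single_eq_const_mult_monomial:
  "Poly_Mapping.single t c = Poly_Mapping.single 0 c * monomial t"
  by (simp add: monomial_def mult_single)

lemma sum_mem_ideal: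
  fixes J :: "'a::comm_ring_1 set"
  assumes "ideal J ring_of_type_algebra" "\<And>x. x \<in> A \<Longrightarrow> f x \<in> J"
  shows "(\<Sum>x\<in>A. f x) \<in> J"
  using assms by (induction A rule: infinite_finite_induct) (auto simp: ideal_ring_of_type_algebra_iff)

lemma mem_ideal_if_monomials:
  fixes f :: "('n::finite, 'k::field) mpoly"
  assumes "ideal J mpoly_ring" "\<And>t. t \<in> Poly_Mapping.keys f \<Longrightarrow> monomial t \<in> J"
  shows "f \<in> J"
proof -
  have "Poly_Mapping.single t (Poly_Mapping.lookup f t) \<in> J" if "t \<in> Poly_Mapping.keys f" for t
    using assms that unfolding ideal_ring_of_type_algebra_iff single_eq_const_mult_monomial[of t]
    by blast
  then show ?thesis
    by (subst poly_mapping_sum_single) (rule sum_mem_ideal[OF assms(1)])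
qed

section \<open>Monomial ideals as sets of exponents\<close>

text \<open>For exponents these are the ideals of the additive monoid, that is, the sets of
  exponents of the monomials in a monomial ideal.\<close>

definition up_closed :: "'a::plus set \<Rightarrow> bool"
  where "up_closed U \<longleftrightarrow> (\<forall>t\<in>U. \<forall>s. t + s \<in> U)"

text \<open>Describing membership by the support turns intersections and inclusions of monomial
  ideals into those of exponent sets.\<close>

definition mspan :: "('n::finite \<Rightarrow>\<^sub>0 nat) set \<Rightarrow> ('n, 'k::field) mpoly set"
  where "mspan U = {f. Poly_Mapping.keys f \<subseteq> U}"

lemma monomial_mem_mspan [simp]: "monomial t \<in> mspan U \<longleftrightarrow> t \<in> U"
  by (simp add: mspan_def)

lemma mspan_inject [simp]: "(mspan U :: ('n::finite, 'k::field) mpoly set) = mspan U' \<longleftrightarrow> U = U'"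
  using monomial_mem_mspan by blast

lemma mspan_INT: "mspan (\<Inter>i\<in>A. U i) = (\<Inter>i\<in>A. mspan (U i))"
  by (auto simp: mspan_def)

lemma mspan_mono: "U \<subseteq> U' \<Longrightarrow> mspan U \<subseteq> mspan U'"
  by (auto simp: mspan_def)

lemma ideal_mspan:
  assumes "up_closed U"
  shows "ideal (mspan U :: ('n::finite, 'k::field) mpoly set) mpoly_ring"
  unfolding ideal_ring_of_type_algebra_iff
proof (intro conjI ballI allI)
  fix a b x :: "('n, 'k) mpoly"
  assume a: "a \<in> mspan U"
  show "a + b \<in> mspan U" if "b \<in> mspan U"
    using keys_add[of a b] a that by (auto simp: mspan_def)
  show "x * a \<in> mspan U"
    using keys_mult[of a x] a assms by (force simp: mspan_def up_closed_def mult.commute)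
qed (simp add: mspan_def)

lemma mspan_subset_ideal:
  assumes "ideal J mpoly_ring" "\<And>t. t \<in> U \<Longrightarrow> monomial t \<in> J"
  shows "mspan U \<subseteq> J"
  using mem_ideal_if_monomials[OF assms(1)] assms(2) by (auto simp: mspan_def)

lemma monomial_ideal_imp_mspan:
  assumes "monomial_ideal I"
  obtains U where "up_closed U" "I = mspan U"
proof -
  interpret cring "mpoly_ring :: ('a, 'b) mpoly ring" ..
  obtain T where T: "I = Idl\<^bsub>mpoly_ring\<^esub> (monomial ` T)"
    using assms by (auto simp: monomial_ideal_def)
  define U where "U = {t + s | t s. t \<in> T}"
  have U: "up_closed U"
    unfolding up_closed_def U_def by (force simp: add.assoc)
  have "monomial t \<in> I" if t: "t \<in> U" for t
  proof -
    obtain u s where us: "t = u + s" "u \<in> T"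
      using t U_def by blast
    have "ideal I mpoly_ring" "monomial u \<in> I"
      using us genideal_ideal[of "monomial ` T"] genideal_self[of "monomial ` T"] by (auto simp: T)
    then show ?thesis
      by (simp add: ideal_ring_of_type_algebra_iff us monomial_add mult.commute[of _ "monomial s"])
  qed
  moreover have "ideal I mpoly_ring"
    by (simp add: T genideal_ideal)
  ultimately have "mspan U \<subseteq> I"
    by (rule mspan_subset_ideal[rotated])
  moreover have "T \<subseteq> U"
    unfolding U_def by (metis (mono_tags, lifting) add.right_neutral mem_Collect_eq subsetI)
  hence "I \<subseteq> mspan U"
    unfolding T by (intro genideal_minimal ideal_mspan U) auto
  ultimately show ?thesis
    using that U by blast
qed

section \<open>Exponents under the substitution of powers for the variables\<close>

lemma finite_type_sum_single:
  fixes t :: "'n::finite \<Rightarrow>\<^sub>0 nat"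
  shows "t = (\<Sum>i\<in>UNIV. Poly_Mapping.single i (Poly_Mapping.lookup t i))"
  by (rule poly_mapping_eqI) (simp add: lookup_sum lookup_single when_def)

lemma indet_eq_monomial: "indet i = monomial (Poly_Mapping.single i 1)"
  by (simp add: indet_def monomial_def)

lemma indet_power: "indet i ^ k = monomial (Poly_Mapping.single i k)"
  by (induction k)
     (simp_all add: monomial_zero indet_def monomial_def mult_single single_add[symmetric])

lemma prod_indet_power:
  "(\<Prod>i\<in>A. indet i ^ f i) = monomial (\<Sum>i\<in>A. Poly_Mapping.single i (f i))"
  by (induction A rule: infinite_finite_induct) (simp_all add: monomial_zero monomial_add indet_power)

definition exp_scale :: "nat \<Rightarrow> ('n::finite \<Rightarrow>\<^sub>0 nat) \<Rightarrow> ('n \<Rightarrow>\<^sub>0 nat)"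
  where "exp_scale m t = Abs_poly_mapping (\<lambda>i. m * Poly_Mapping.lookup t i)"

definition exp_div :: "('n::finite \<Rightarrow>\<^sub>0 nat) \<Rightarrow> nat \<Rightarrow> ('n \<Rightarrow>\<^sub>0 nat)"
  where "exp_div t m = Abs_poly_mapping (\<lambda>i. Poly_Mapping.lookup t i div m)"

lemma lookup_exp_scale [simp]: "Poly_Mapping.lookup (exp_scale m t) i = m * Poly_Mapping.lookup t i"
  by (simp add: exp_scale_def)

lemma lookup_exp_div [simp]: "Poly_Mapping.lookup (exp_div t m) i = Poly_Mapping.lookup t i div m"
  by (simp add: exp_div_def)

lemma exp_le_imp_add:
  fixes s t :: "'n::finite \<Rightarrow>\<^sub>0 nat"
  assumes "\<And>i. Poly_Mapping.lookup s i \<le> Poly_Mapping.lookup t i"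
  obtains u where "t = s + u"
proof
  show "t = s + Abs_poly_mapping (\<lambda>i. Poly_Mapping.lookup t i - Poly_Mapping.lookup s i)"
    using assms by (intro poly_mapping_eqI) (simp add: lookup_add)
qed

lemma up_closed_mono:
  fixes U :: "('n::finite \<Rightarrow>\<^sub>0 nat) set"
  assumes "up_closed U" "s \<in> U" "\<And>i. Poly_Mapping.lookup s i \<le> Poly_Mapping.lookup t i"
  shows "t \<in> U"
  using assms exp_le_imp_add[of s t] unfolding up_closed_def by metis

lemma exp_div_exp_scale: "m > 0 \<Longrightarrow> exp_div (exp_scale m t + s) m = t + exp_div s m"
  by (rule poly_mapping_eqI) (simp add: lookup_add)

lemma exp_div_exp_scale' [simp]: "m > 0 \<Longrightarrow> exp_div (exp_scale m t) m = t"
  by (rule poly_mapping_eqI) simp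

lemma square_power_poly_eq:
  fixes f :: "('n::finite, 'k::field) mpoly"
  shows "square_power_poly f m =
    (\<Sum>t\<in>Poly_Mapping.keys f. Poly_Mapping.single (exp_scale m t) (Poly_Mapping.lookup f t))"
proof -
  have "(\<Prod>i\<in>UNIV. (indet i ^ m) ^ Poly_Mapping.lookup t i) =
      (monomial (exp_scale m t) :: ('n, 'k) mpoly)" for t
    using prod_indet_power[of "\<lambda>i. m * Poly_Mapping.lookup t i" UNIV]
      finite_type_sum_single[of "exp_scale m t"]
    by (simp flip: power_mult)
  then show ?thesis
    by (simp add: square_power_poly_def substitute_def flip: single_eq_const_mult_monomial)
qed

text \<open>For \<open>m > 0\<close>, \<open>m * u \<le> t\<close> holds componentwise iff
  \<open>u \<le> t div m\<close>; so for up-closed \<open>U\<close> these are the exponents of the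
  multiples of the monomials \<open>X^(m * u)\<close> with \<open>u \<in> U\<close>. Being a
  preimage, the set commutes with intersections.\<close>

definition exp_dilate :: "nat \<Rightarrow> ('n::finite \<Rightarrow>\<^sub>0 nat) set \<Rightarrow> ('n \<Rightarrow>\<^sub>0 nat) set"
  where "exp_dilate m U = {t. exp_div t m \<in> U}"

lemma up_closed_exp_dilate:
  assumes "up_closed U"
  shows "up_closed (exp_dilate m U)"
  unfolding up_closed_def exp_dilate_def
proof (clarify)
  fix t s
  assume "exp_div t m \<in> U"
  with assms show "exp_div (t + s) m \<in> U"
    by (rule up_closed_mono) (simp add: lookup_add div_le_mono)
qed

lemma square_power_mspan:
  assumes "up_closed U" "m > 0"
  shows "square_power (mspan U :: ('n::finite, 'k::field) mpoly set) m = mspan (exp_dilate m U)"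
proof -
  interpret cring "mpoly_ring :: ('n, 'k) mpoly ring" ..
  let ?J = "square_power (mspan U :: ('n, 'k) mpoly set) m"
  let ?G = "{square_power_poly f m | f. f \<in> (mspan U :: ('n, 'k) mpoly set)}"
  have J: "ideal ?J mpoly_ring" "?G \<subseteq> ?J"
    unfolding square_power_def using genideal_ideal[of ?G] genideal_self[of ?G] by simp_all
  have ideal: "ideal (mspan (exp_dilate m U) :: ('n, 'k) mpoly set) mpoly_ring"
    by (intro ideal_mspan up_closed_exp_dilate assms)
  have "square_power_poly f m \<in> mspan (exp_dilate m U)" if "f \<in> mspan U" for f :: "('n, 'k) mpoly"
    unfolding square_power_poly_eq
  proof (rule sum_mem_ideal[OF ideal])
    fix t assume "t \<in> Poly_Mapping.keys f"
    then show "Poly_Mapping.single (exp_scale m t) (Poly_Mapping.lookup f t) \<in> mspan (exp_dilate m U)"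
      using that assms(2) by (auto simp: mspan_def exp_dilate_def)
  qed
  then have "?J \<subseteq> mspan (exp_dilate m U)"
    unfolding square_power_def by (intro genideal_minimal ideal) auto
  moreover have "mspan (exp_dilate m U) \<subseteq> ?J"
  proof (rule mspan_subset_ideal[OF J(1)])
    fix t assume t: "t \<in> exp_dilate m U"
    \<comment> \<open>Division with remainder in each coordinate exhibits \<open>X^t\<close> as a
      multiple of a generator of the square power.\<close>
    obtain s where s: "t = exp_scale m (exp_div t m) + s"
      by (rule exp_le_imp_add[of "exp_scale m (exp_div t m)" t]) auto
    have "square_power_poly (monomial (exp_div t m) :: ('n, 'k) mpoly) m =
        monomial (exp_scale m (exp_div t m))"
      by (simp add: square_power_poly_eq) (simp add: monomial_def)
    moreover have "square_power_poly (monomial (exp_div t m) :: ('n, 'k) mpoly) m \<in> ?J"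
    proof -
      have "monomial (exp_div t m) \<in> (mspan U :: ('n, 'k) mpoly set)"
        using t by (simp add: exp_dilate_def)
      then show ?thesis
        using J(2) by blast
    qed
    ultimately have "monomial s * monomial (exp_scale m (exp_div t m)) \<in> ?J"
      using J(1) unfolding ideal_ring_of_type_algebra_iff by simp
    then show "monomial t \<in> ?J"
      by (subst s) (simp add: monomial_add mult.commute)
  qed
  ultimately show ?thesis ..
qed

section \<open>Monomial primary ideals\<close>

text \<open>\<open>mspan (hits V)\<close> is the prime ideal generated by the variables in
  \<open>V\<close>.\<close>

definition hits :: "'n::finite set \<Rightarrow> ('n \<Rightarrow>\<^sub>0 nat) set"
  where "hits V = {t. \<exists>i\<in>V. Poly_Mapping.lookup t i \<noteq> 0}"

lemma up_closed_hits: "up_closed (hits V)"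
  by (force simp: up_closed_def hits_def lookup_add)

text \<open>For up-closed \<open>U\<close>, cancelling a single factor \<open>X_i\<close> from
  monomials already expresses that \<open>X_i\<close> is a non-zero-divisor modulo
  \<open>mspan U\<close>.\<close>

definition saturated :: "('n::finite \<Rightarrow>\<^sub>0 nat) set \<Rightarrow> 'n \<Rightarrow> bool"
  where "saturated U i \<longleftrightarrow> (\<forall>t. t + Poly_Mapping.single i 1 \<in> U \<longrightarrow> t \<in> U)"

text \<open>These are the variables in the radical of \<open>mspan U\<close>. The value
  \<open>k = 0\<close> can occur only if \<open>0 \<in> U\<close>, that is, for the unit ideal when
  \<open>U\<close> is up-closed.\<close>

definition power_vars :: "('n::finite \<Rightarrow>\<^sub>0 nat) set \<Rightarrow> 'n set"
  where "power_vars U = {i. \<exists>k. Poly_Mapping.single i k \<in> U}"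

lemma saturated_add_single:
  assumes "saturated U i" "t + Poly_Mapping.single i k \<in> U"
  shows "t \<in> U"
  using assms(2)
proof (induction k)
  case (Suc k)
  have "(t + Poly_Mapping.single i k) + Poly_Mapping.single i 1 \<in> U"
    using Suc.prems by (simp add: add.assoc flip: single_add)
  then show ?case
    using assms(1) Suc.IH unfolding saturated_def by blast
qed simp

text \<open>The monomial of \<open>s\<close> is a product of powers of variables outside
  \<open>V\<close>, which saturation cancels one variable at a time.\<close>

lemma saturated_cancel:
  fixes s :: "'n::finite \<Rightarrow>\<^sub>0 nat"
  assumes "\<And>i. i \<notin> V \<Longrightarrow> saturated U i" "t + s \<in> U" "s \<notin> hits V"
  shows "t \<in> U"
proof -
  have cancel: "t + (\<Sum>i\<in>A. Poly_Mapping.single i (Poly_Mapping.lookup s i)) \<in> U \<Longrightarrow> t \<in> U"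
    if "A \<inter> V = {}" for A
    using finite[of A] that
  proof (induction A rule: finite_induct)
    case (insert i A)
    then have "t + (\<Sum>i\<in>A. Poly_Mapping.single i (Poly_Mapping.lookup s i))
        + Poly_Mapping.single i (Poly_Mapping.lookup s i) \<in> U"
      by (simp add: add_ac)
    then have "t + (\<Sum>i\<in>A. Poly_Mapping.single i (Poly_Mapping.lookup s i)) \<in> U"
      using insert.prems assms(1) by (auto intro: saturated_add_single)
    then show ?case
      using insert by blast
  qed simp
  have "s = (\<Sum>i\<in>-V. Poly_Mapping.single i (Poly_Mapping.lookup s i))"
    by (subst finite_type_sum_single, rule sum.mono_neutral_right)
       (use assms(3) in \<open>auto simp: hits_def\<close>)
  then show ?thesis
    using cancel[of "-V"] assms(2) by auto
qed

text \<open>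
  The index type \<open>'n\<close> carries no linear order, so a monomial order is obtained by comparing the
  images of exponents under \<open>t \<mapsto> \<Prod>i. p\<^sub>i ^ t\<^sub>i\<close> for distinct primes \<open>p\<^sub>i\<close>.
\<close>
lemma exponent_encoding:
  obtains \<phi> :: "('n::finite \<Rightarrow>\<^sub>0 nat) \<Rightarrow> nat"
  where "inj \<phi>" "\<And>s t. \<phi> (s + t) = \<phi> s * \<phi> t" "\<And>t. \<phi> t > 0"
proof -
  obtain f :: "'n \<Rightarrow> nat" where f: "inj f" "\<And>i. prime (f i)"
    using infinite_arbitrarily_large[OF primes_infinite, of "card (UNIV :: 'n set)"]
    by (metis (mono_tags, lifting) bij_betw_def finite finite_same_card_bij mem_Collect_eq rangeI subset_iff)
  define \<phi> where "\<phi> t = (\<Prod>i\<in>UNIV. f i ^ Poly_Mapping.lookup t i)" for t :: "'n \<Rightarrow>\<^sub>0 nat"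
  \<comment> \<open>Unique factorization recovers every exponent from the product, which yields
    injectivity.\<close>
  have "multiplicity (f j) (\<phi> t) = Poly_Mapping.lookup t j" for j t
  proof -
    have "\<phi> t = (\<Prod>p\<in>range f. p ^ Poly_Mapping.lookup t (inv_into UNIV f p))"
      using f(1) by (simp add: \<phi>_def prod.reindex)
    then show ?thesis
      using f multiplicity_prod_prime_powers[of "range f" "f j"
          "\<lambda>p. Poly_Mapping.lookup t (inv_into UNIV f p)"] by auto
  qed
  then have "inj \<phi>"
    by (metis injI poly_mapping_eqI)
  moreover have "\<phi> t > 0" for t
    using f(2) by (simp add: \<phi>_def prod_pos prime_gt_0_nat)
  ultimately show ?thesis
    by (intro that[of \<phi>]) (auto simp: \<phi>_def lookup_add power_add prod.distrib)
qed

text \<open>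
  After removing from \<open>a\<close> the terms in \<open>U\<close>, compare exponents first by their total degree \<open>d\<close> in the
  variables of \<open>V\<close> and then by \<open>\<phi>\<close>. The least terms of \<open>a\<close> and \<open>b\<close> multiply without cancellation,
  and the one of \<open>b\<close> avoids \<open>V\<close>, so saturation puts the one of \<open>a\<close> into \<open>U\<close>.
\<close>
lemma mult_mem_mspan_cancel:
  fixes a b :: "('n::finite, 'k::field) mpoly"
  assumes U: "up_closed U" and sat: "\<And>i. i \<notin> V \<Longrightarrow> saturated U i"
    and ab: "a * b \<in> mspan U" and b: "b \<notin> mspan (hits V)"
  shows "a \<in> mspan U"
proof (rule ccontr)
  assume "a \<notin> mspan U"
  define c where "c = (\<Sum>t\<in>Poly_Mapping.keys a \<inter> U. Poly_Mapping.single t (Poly_Mapping.lookup a t))"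
  define a' where "a' = a - c"
  have "Poly_Mapping.lookup c t = (if t \<in> U then Poly_Mapping.lookup a t else 0)" for t
    by (auto simp: c_def lookup_sum lookup_single when_def in_keys_iff)
  then have keys_c: "Poly_Mapping.keys c \<subseteq> U"
    and keys_a': "Poly_Mapping.keys a' = Poly_Mapping.keys a - U"
    by (auto simp: a'_def in_keys_iff lookup_minus split: if_splits)
  \<comment> \<open>Passing from \<open>a\<close> to \<open>a'\<close> changes the product by a
    multiple of \<open>c\<close>, which lies in the ideal.\<close>
  have "a' * b \<in> mspan U"
  proof -
    have ideal: "ideal (mspan U :: ('n, 'k) mpoly set) mpoly_ring"
      using U by (rule ideal_mspan)
    have "a' * b = a * b + (- b) * c"
      by (simp add: a'_def algebra_simps)
    moreover have "c \<in> mspan U"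
      using keys_c by (simp add: mspan_def)
    ultimately show ?thesis
      using ideal ab unfolding ideal_ring_of_type_algebra_iff by metis
  qed

  obtain \<phi> :: "('n \<Rightarrow>\<^sub>0 nat) \<Rightarrow> nat"
    where \<phi>: "inj \<phi>" "\<And>s t. \<phi> (s + t) = \<phi> s * \<phi> t" "\<And>t. \<phi> t > 0"
    using exponent_encoding by blast
  define d where "d t = (\<Sum>i\<in>V. Poly_Mapping.lookup t i)" for t :: "'n \<Rightarrow>\<^sub>0 nat"
  have d_add: "d (s + t) = d s + d t" for s t
    by (simp add: d_def lookup_add sum.distrib)
  have d_zero: "d t = 0 \<longleftrightarrow> t \<notin> hits V" for t
    by (auto simp: d_def hits_def)

  obtain u0 where u0: "u0 \<in> Poly_Mapping.keys a'"
      "\<And>u. u \<in> Poly_Mapping.keys a' \<Longrightarrow> d u0 \<le> d u"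
    using ex_has_least_nat[of "\<lambda>u. u \<in> Poly_Mapping.keys a'" _ d] \<open>a \<notin> mspan U\<close>
    by (auto simp: keys_a' mspan_def)
  obtain u where u: "u \<in> Poly_Mapping.keys a'" "d u = d u0"
      "\<And>u'. u' \<in> Poly_Mapping.keys a' \<Longrightarrow> d u' = d u0 \<Longrightarrow> \<phi> u \<le> \<phi> u'"
    using ex_has_least_nat[of "\<lambda>u. u \<in> Poly_Mapping.keys a' \<and> d u = d u0" u0 \<phi>] u0(1) by auto
  obtain s where s: "s \<in> Poly_Mapping.keys b" "d s = 0"
      "\<And>s'. s' \<in> Poly_Mapping.keys b \<Longrightarrow> d s' = 0 \<Longrightarrow> \<phi> s \<le> \<phi> s'"
  proof -
    \<comment> \<open>Some term of \<open>b\<close> lies outside \<open>hits V\<close>, so the least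
      degree in the variables of \<open>V\<close> is 0.\<close>
    obtain s0 where "s0 \<in> Poly_Mapping.keys b \<and> d s0 = 0"
      using b by (auto simp: mspan_def d_zero)
    then show ?thesis
      using ex_has_least_nat[of "\<lambda>s. s \<in> Poly_Mapping.keys b \<and> d s = 0" s0 \<phi>] that by blast
  qed

  have "u' = u \<and> s' = s"
    if us': "u' \<in> Poly_Mapping.keys a'" "s' \<in> Poly_Mapping.keys b" "u' + s' = u + s" for u' s'
  proof -
    \<comment> \<open>As \<open>d\<close> is additive and both \<open>d u0\<close> and
      \<open>d s = 0\<close> are minimal, equal sums force equal degrees; the rest is left to
      \<open>\<phi>\<close>.\<close>
    have "d u' + d s' = d u + d s"
      using us'(3) d_add by metis
    then have "d u' = d u0" "d s' = 0"
      using u(2) s(2) u0(2)[OF us'(1)] by simp_all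
    then have le: "\<phi> u \<le> \<phi> u'" "\<phi> s \<le> \<phi> s'"
      using u(3) s(3) us' by auto
    have eq: "\<phi> u' * \<phi> s' = \<phi> u * \<phi> s"
      using us'(3) \<phi>(2) by metis
    have "\<phi> u' \<le> \<phi> u"
    proof (rule ccontr)
      assume "\<not> \<phi> u' \<le> \<phi> u"
      then have "\<phi> u * \<phi> s < \<phi> u' * \<phi> s'"
        using le \<phi>(3)[of s] by (intro mult_less_le_imp_less) auto
      then show False
        using eq by simp
    qed
    then have "u' = u"
      using le \<phi>(1) by (simp add: inj_eq)
    then show ?thesis
      using us'(3) by simp
  qed
  then have "Poly_Mapping.lookup (a' * b) (u + s) = Poly_Mapping.lookup a' u * Poly_Mapping.lookup b s"
    by (rule lookup_mult_unique)
  then have "Poly_Mapping.lookup (a' * b) (u + s) \<noteq> 0"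
    using u(1) s(1) by (simp add: in_keys_iff)
  then have "u + s \<in> U"
    using \<open>a' * b \<in> mspan U\<close> by (auto simp: mspan_def in_keys_iff)
  then have "u \<in> U"
    using saturated_cancel[OF sat] s(2) d_zero by blast
  then show False
    using u(1) keys_a' by simp
qed

text \<open>Every variable outside \<open>V\<close> is saturated for \<open>hits V\<close>, so
  cancellation modulo \<open>mspan (hits V)\<close> is primality itself.\<close>

lemma primeideal_mspan_hits: "primeideal (mspan (hits V) :: ('n::finite, 'k::field) mpoly set) mpoly_ring"
  unfolding primeideal_ring_of_type_algebra_iff
proof (intro conjI allI impI)
  have "1 \<notin> (mspan (hits V) :: ('n, 'k) mpoly set)"
    by (simp add: mspan_def hits_def)
  then show "(mspan (hits V) :: ('n, 'k) mpoly set) \<noteq> UNIV"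
    by blast
  fix a b :: "('n, 'k) mpoly"
  have "saturated (hits V) i" if "i \<notin> V" for i
    using that by (auto simp: saturated_def hits_def lookup_add lookup_single when_def)
  then show "a * b \<in> mspan (hits V) \<Longrightarrow> a \<in> mspan (hits V) \<or> b \<in> mspan (hits V)"
    using mult_mem_mspan_cancel[OF up_closed_hits] by blast
qed (intro ideal_mspan up_closed_hits)

text \<open>Each term of \<open>b\<close> involves a variable with a power in the ideal, so the
  terms of \<open>b ^ N\<close> have degree at least \<open>N\<close> in these variables. For large
  \<open>N\<close>, the pigeonhole principle makes one exponent large enough.\<close>

lemma power_mem_mspan:
  fixes b :: "('n::finite, 'k::field) mpoly"
  assumes U: "up_closed U" and b: "b \<in> mspan (hits (power_vars U))"
  shows "\<exists>k>0. b ^ k \<in> mspan U"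
proof -
  let ?V = "power_vars U"
  have "\<forall>i\<in>?V. \<exists>k. Poly_Mapping.single i k \<in> U"
    by (simp add: power_vars_def)
  then obtain k where k: "\<And>i. i \<in> ?V \<Longrightarrow> Poly_Mapping.single i (k i) \<in> U"
    by metis
  define d where "d t = (\<Sum>i\<in>?V. Poly_Mapping.lookup t i)" for t :: "'n \<Rightarrow>\<^sub>0 nat"
  have deg: "N \<le> d t" if "t \<in> Poly_Mapping.keys (b ^ N)" for N t
    using that
  proof (induction N arbitrary: t)
    case (Suc N)
    then obtain u v where uv: "t = u + v" "u \<in> Poly_Mapping.keys b" "v \<in> Poly_Mapping.keys (b ^ N)"
      using keys_mult[of b "b ^ N"] by auto
    have "u \<in> hits ?V"
      using b uv by (auto simp: mspan_def)
    then have "d u \<noteq> 0"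
      by (auto simp: d_def hits_def)
    moreover have "d t = d u + d v"
      by (simp add: uv(1) d_def lookup_add sum.distrib)
    ultimately show ?case
      using Suc.IH[OF uv(3)] by simp
  qed simp
  \<comment> \<open>A total degree above the sum of the \<open>k i\<close> forces some coordinate
    above its \<open>k i\<close>; the successor also makes the power positive.\<close>
  define N where "N = Suc (\<Sum>i\<in>?V. k i)"
  have "t \<in> U" if t: "t \<in> Poly_Mapping.keys (b ^ N)" for t
  proof -
    have "(\<Sum>i\<in>?V. k i) < (\<Sum>i\<in>?V. Poly_Mapping.lookup t i)"
      using deg[OF t] by (simp add: N_def d_def)
    then obtain i where i: "i \<in> ?V" "k i < Poly_Mapping.lookup t i"
      by (meson leD not_le_imp_less sum_mono)
    show ?thesis
      by (rule up_closed_mono[OF U k[OF i(1)]]) (use i(2) in \<open>auto simp: lookup_single when_def\<close>)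
  qed
  then have "b ^ N \<in> mspan U"
    by (auto simp: mspan_def)
  then show ?thesis
    unfolding N_def by blast
qed

text \<open>\<open>0 \<notin> U\<close> is properness. Forwards, the primary condition is tested on
  \<open>X^t * X_i\<close>. Backwards, a factor in \<open>mspan (hits (power_vars U))\<close> has a
  power in the ideal, and any other factor can be cancelled.\<close>

lemma primary_ideal_mspan_iff:
  assumes U: "up_closed U"
  shows "primary_ideal (mspan U :: ('n::finite, 'k::field) mpoly set) mpoly_ring \<longleftrightarrow>
    0 \<notin> U \<and> (\<forall>i. i \<notin> power_vars U \<longrightarrow> saturated U i)"
proof
  assume prim: "primary_ideal (mspan U :: ('n, 'k) mpoly set) mpoly_ring"
  have "saturated U i" if "i \<notin> power_vars U" for i
    unfolding saturated_def
  proof (intro allI impI)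
    fix t assume "t + Poly_Mapping.single i 1 \<in> U"
    then have "(monomial t * indet i :: ('n, 'k) mpoly) \<in> mspan U"
      by (simp add: indet_eq_monomial flip: monomial_add)
    then have "monomial t \<in> (mspan U :: ('n, 'k) mpoly set) \<or>
        (\<exists>k>0. (indet i :: ('n, 'k) mpoly) ^ k \<in> mspan U)"
      using prim unfolding primary_ideal_ring_of_type_algebra_iff by blast
    then show "t \<in> U"
      using that by (auto simp: indet_power power_vars_def)
  qed
  moreover have "0 \<notin> U"
  proof
    assume "0 \<in> U"
    then have "U = UNIV"
      using U unfolding up_closed_def by (metis UNIV_eq_I add_0)
    then show False
      using prim by (simp add: primary_ideal_ring_of_type_algebra_iff mspan_def)
  qed
  ultimately show "0 \<notin> U \<and> (\<forall>i. i \<notin> power_vars U \<longrightarrow> saturated U i)"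
    by blast
next
  assume comb: "0 \<notin> U \<and> (\<forall>i. i \<notin> power_vars U \<longrightarrow> saturated U i)"
  then have "1 \<notin> (mspan U :: ('n, 'k) mpoly set)"
    by (simp add: mspan_def)
  then have "(mspan U :: ('n, 'k) mpoly set) \<noteq> UNIV"
    by blast
  then show "primary_ideal (mspan U :: ('n, 'k) mpoly set) mpoly_ring"
    unfolding primary_ideal_ring_of_type_algebra_iff
    using ideal_mspan[OF U] mult_mem_mspan_cancel[OF U] power_mem_mspan[OF U] comb by blast
qed

lemma primary_ideal_mspan_exp_dilate:
  assumes U: "up_closed U" and m: "m > 0"
    and prim: "primary_ideal (mspan U :: ('n::finite, 'k::field) mpoly set) mpoly_ring"
  shows "primary_ideal (mspan (exp_dilate m U) :: ('n, 'k) mpoly set) mpoly_ring"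
proof -
  have 0: "0 \<notin> U" and sat: "\<And>i. i \<notin> power_vars U \<Longrightarrow> saturated U i"
    using prim U by (simp_all add: primary_ideal_mspan_iff)
  have div0: "exp_div 0 m = 0"
    by (rule poly_mapping_eqI) simp
  have div_single: "exp_div (Poly_Mapping.single i (m * k)) m = Poly_Mapping.single i k" for i :: 'n and k
    using m by (intro poly_mapping_eqI) (simp add: lookup_single when_def)
  \<comment> \<open>One inclusion suffices: a variable outside the larger set is outside the smaller
    one, hence saturated for \<open>U\<close>.\<close>
  have "power_vars U \<subseteq> power_vars (exp_dilate m U)"
  proof
    fix i assume "i \<in> power_vars U"
    then obtain k where "Poly_Mapping.single i k \<in> U"
      by (auto simp: power_vars_def)
    then have "Poly_Mapping.single i (m * k) \<in> exp_dilate m U"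
      by (simp add: exp_dilate_def div_single)
    then show "i \<in> power_vars (exp_dilate m U)"
      by (auto simp: power_vars_def)
  qed
  moreover have "saturated (exp_dilate m U) i" if "saturated U i" for i
    unfolding saturated_def exp_dilate_def mem_Collect_eq
  proof (intro allI impI)
    fix t assume "exp_div (t + Poly_Mapping.single i 1) m \<in> U"
    \<comment> \<open>Raising a coordinate by 1 raises its quotient by at most 1.\<close>
    then have "exp_div t m + Poly_Mapping.single i 1 \<in> U"
      by (rule up_closed_mono[OF U]) (simp add: lookup_add lookup_single when_def div_Suc)
    then show "exp_div t m \<in> U"
      using that by (simp add: saturated_def)
  qed
  moreover have "0 \<notin> exp_dilate m U"
    using 0 by (simp add: exp_dilate_def div0)
  ultimately show ?thesis
    unfolding primary_ideal_mspan_iff[OF up_closed_exp_dilate[OF U]] using sat by blast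
qed

section \<open>Associated primes\<close>

text \<open>The decomposition forces associated primes to be generated by variables; the resulting
  description mentions only \<open>U\<close> and can be compared across square powers.\<close>

lemma Ass_mspan:
  fixes U :: "('n::finite \<Rightarrow>\<^sub>0 nat) set"
  assumes U: "up_closed U"
    and dec: "primary_decomposition mpoly_ring (mspan U :: ('n, 'k::field) mpoly set) r (\<lambda>i. mspan (W i))"
    and W: "\<And>i. i \<in> {1..r} \<Longrightarrow> up_closed (W i)"
  shows "Ass mpoly_ring (mspan U :: ('n, 'k) mpoly set) =
    {mspan (hits V) | V. \<exists>t. \<forall>s. s + t \<in> U \<longleftrightarrow> s \<in> hits V}"
proof -
  interpret cring "mpoly_ring :: ('n, 'k) mpoly ring" ..
  let ?I = "mspan U :: ('n, 'k) mpoly set"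
  have ideal: "ideal ?I mpoly_ring"
    using U by (rule ideal_mspan)
  have I: "?I = (\<Inter>i\<in>{1..r}. mspan (W i))"
    and prim: "\<And>i. i \<in> {1..r} \<Longrightarrow> primary_ideal (mspan (W i) :: ('n, 'k) mpoly set) mpoly_ring"
    using dec unfolding primary_decomposition_def by auto
  have Ass: "P \<in> Ass mpoly_ring ?I \<longleftrightarrow> primeideal P mpoly_ring \<and> (\<exists>f. P = {a. a * f \<in> ?I})" for P
    using Ass_eq[OF ideal] by simp
  have *: "\<exists>V t. P = mspan (hits V) \<and> (\<forall>s. s + t \<in> U \<longleftrightarrow> s \<in> hits V)"
    if P: "primeideal P mpoly_ring" and f: "P = {a. a * f \<in> ?I}" for P f
  proof -
    have idealP: "ideal P mpoly_ring"
      using P by (simp add: primeideal_ring_of_type_algebra_iff)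
    \<comment> \<open>Otherwise each \<open>mspan (W i) : f\<close> has an element outside
      \<open>P\<close>, and the product of these lies in \<open>I : f = P\<close>. For
      \<open>r = 0\<close> this product is 1.\<close>
    have "\<exists>i\<in>{1..r}. {a. a * f \<in> mspan (W i)} \<subseteq> P"
    proof (rule ccontr)
      assume "\<not> ?thesis"
      then have "\<forall>i\<in>{1..r}. \<exists>a. a * f \<in> mspan (W i) \<and> a \<notin> P"
        by blast
      then obtain g where g: "\<And>i. i \<in> {1..r} \<Longrightarrow> g i * f \<in> mspan (W i)"
          "\<And>i. i \<in> {1..r} \<Longrightarrow> g i \<notin> P"
        by metis
      have "(\<Prod>i\<in>{1..r}. g i) * f \<in> mspan (W j)" if j: "j \<in> {1..r}" for j
      proof -
        have "(\<Prod>i\<in>{1..r}. g i) * f = (\<Prod>i\<in>{1..r} - {j}. g i) * (g j * f)"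
          using j by (subst prod.remove[of "{1..r}" j]) (simp_all add: mult_ac)
        then show ?thesis
          using g(1)[OF j] ideal_mspan[OF W[OF j], where ?'k = 'k]
          unfolding ideal_ring_of_type_algebra_iff by metis
      qed
      then have "(\<Prod>i\<in>{1..r}. g i) \<in> P"
        unfolding f I by blast
      then show False
        using prod_mem_primeideal[OF P] g(2) by blast
    qed
    then obtain i where i: "i \<in> {1..r}" and "{a. a * f \<in> mspan (W i)} \<subseteq> P"
      by blast
    moreover have "P \<subseteq> {a. a * f \<in> mspan (W i)}"
      using i unfolding f I by blast
    ultimately have P_eq: "P = {a. a * f \<in> mspan (W i)}"
      by blast
    define V where "V = power_vars (W i)"
    have "f \<notin> mspan (W i)"
      using P P_eq ideal_mspan[OF W[OF i], where ?'k = 'k]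
      unfolding primeideal_ring_of_type_algebra_iff ideal_ring_of_type_algebra_iff by blast
    \<comment> \<open>An element of \<open>P\<close> outside \<open>mspan (hits V)\<close> could be
      cancelled from its product with \<open>f\<close>, putting \<open>f\<close> into
      \<open>mspan (W i)\<close>.\<close>
    then have "P \<subseteq> mspan (hits V)"
      using mult_mem_mspan_cancel[OF W[OF i], of V f] prim[OF i] P_eq
      unfolding primary_ideal_mspan_iff[OF W[OF i]] V_def by (auto simp: mult.commute)
    \<comment> \<open>A variable in \<open>V\<close> has a power in \<open>mspan (W i)\<close>,
      hence in the prime \<open>P\<close>, which then contains the variable.\<close>
    moreover have "mspan (hits V) \<subseteq> P"
    proof (rule mspan_subset_ideal[OF idealP])
      fix t assume "t \<in> hits V"
      then obtain j where j: "j \<in> V" "Poly_Mapping.lookup t j \<noteq> 0"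
        by (auto simp: hits_def)
      obtain k where "Poly_Mapping.single j k \<in> W i"
        using j by (auto simp: V_def power_vars_def)
      then have "f * monomial (Poly_Mapping.single j k) \<in> mspan (W i)"
        using ideal_mspan[OF W[OF i], where ?'k = 'k]
        unfolding ideal_ring_of_type_algebra_iff by simp
      then have "indet j ^ k \<in> P"
        by (simp add: P_eq indet_power mult.commute)
      then have "indet j \<in> P"
        by (rule power_mem_primeideal[OF P])
      obtain s where s: "t = Poly_Mapping.single j 1 + s"
        by (rule exp_le_imp_add[of "Poly_Mapping.single j 1" t])
           (use j(2) in \<open>auto simp: lookup_single when_def\<close>)
      have "monomial t = monomial s * indet j"
        by (simp add: s monomial_add indet_eq_monomial mult.commute)
      then show "monomial t \<in> P"
        using \<open>indet j \<in> P\<close> idealP unfolding ideal_ring_of_type_algebra_iff by metis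
    qed
    ultimately have PV: "P = mspan (hits V)"
      by blast
    \<comment> \<open>Multiplication by a monomial causes no cancellation, so membership in a
      monomial ideal can be read off term by term.\<close>
    have sub: "s + t \<in> U" if "s \<in> hits V" "t \<in> Poly_Mapping.keys f" for s t
    proof -
      have "monomial s * f \<in> ?I"
        using that PV f by (metis (mono_tags, lifting) mem_Collect_eq monomial_mem_mspan)
      then show ?thesis
        using that by (auto simp: mspan_def keys_monomial_mult)
    qed
    \<comment> \<open>Otherwise each term of \<open>f\<close> is carried into the ideal by a
      monomial outside \<open>P\<close>. The product of these monomials carries all of
      \<open>f\<close> there, so it lies in \<open>P\<close>, against primality.\<close>
    have "\<exists>t\<in>Poly_Mapping.keys f. \<forall>s. s + t \<in> U \<longrightarrow> s \<in> hits V"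
    proof (rule ccontr)
      assume "\<not> ?thesis"
      then obtain s where s: "\<And>t. t \<in> Poly_Mapping.keys f \<Longrightarrow> s t + t \<in> U \<and> s t \<notin> hits V"
        by metis
      let ?g = "\<Prod>t\<in>Poly_Mapping.keys f. monomial (s t) :: ('n, 'k) mpoly"
      have "f * ?g \<in> ?I"
      proof (subst poly_mapping_sum_single[of f], unfold sum_distrib_right, rule sum_mem_ideal[OF ideal])
        fix t assume t: "t \<in> Poly_Mapping.keys f"
        have "Poly_Mapping.single t (Poly_Mapping.lookup f t) * ?g =
            (Poly_Mapping.single 0 (Poly_Mapping.lookup f t) *
              (\<Prod>t\<in>Poly_Mapping.keys f - {t}. monomial (s t))) * monomial (s t + t)"
          using t by (subst single_eq_const_mult_monomial)
            (simp add: prod.remove[of _ t] monomial_add mult_ac)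
        moreover have "monomial (s t + t) \<in> ?I"
          using s[OF t] by simp
        ultimately show "Poly_Mapping.single t (Poly_Mapping.lookup f t) * ?g \<in> ?I"
          using ideal unfolding ideal_ring_of_type_algebra_iff by metis
      qed
      then have "?g \<in> P"
        by (simp add: f mult.commute)
      then obtain t where "t \<in> Poly_Mapping.keys f" "monomial (s t) \<in> P"
        using prod_mem_primeideal[OF P finite_keys] by blast
      then show False
        using s PV by auto
    qed
    then show ?thesis
      using sub PV by blast
  qed
  have "mspan (hits V) \<in> Ass mpoly_ring ?I" if t: "\<And>s. s + t \<in> U \<longleftrightarrow> s \<in> hits V" for V t
  proof -
    have "a * monomial t \<in> ?I \<longleftrightarrow> a \<in> mspan (hits V)" for a :: "('n, 'k) mpoly"
      using t by (auto simp: mult.commute[of a] mspan_def keys_monomial_mult image_subset_iff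
          subset_iff add.commute[of t])
    then show ?thesis
      unfolding Ass using primeideal_mspan_hits by blast
  qed
  then have "{mspan (hits V) | V. \<exists>t. \<forall>s. s + t \<in> U \<longleftrightarrow> s \<in> hits V} \<subseteq> Ass mpoly_ring ?I"
    by auto
  moreover have "Ass mpoly_ring ?I \<subseteq> {mspan (hits V) | V. \<exists>t. \<forall>s. s + t \<in> U \<longleftrightarrow> s \<in> hits V}"
  proof
    fix P assume "P \<in> Ass mpoly_ring ?I"
    then obtain f where "primeideal P mpoly_ring" "P = {a. a * f \<in> ?I}"
      unfolding Ass by blast
    from *[OF this] show "P \<in> {mspan (hits V) | V. \<exists>t. \<forall>s. s + t \<in> U \<longleftrightarrow> s \<in> hits V}"
      by simp
  qed
  ultimately show ?thesis
    by (rule subset_antisym[rotated])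
qed

lemma exists_witness_exp_dilate_iff:
  fixes U :: "('n::finite \<Rightarrow>\<^sub>0 nat) set"
  assumes m: "m > 0"
  shows "(\<exists>t. \<forall>s. s + t \<in> exp_dilate m U \<longleftrightarrow> s \<in> hits V) \<longleftrightarrow> (\<exists>t. \<forall>s. s + t \<in> U \<longleftrightarrow> s \<in> hits V)"
proof
  assume "\<exists>t. \<forall>s. s + t \<in> exp_dilate m U \<longleftrightarrow> s \<in> hits V"
  then obtain t where t: "\<And>s. s + t \<in> exp_dilate m U \<longleftrightarrow> s \<in> hits V"
    by blast
  \<comment> \<open>Multiples of \<open>m\<close> suffice as tests: \<open>exp_scale m s\<close>
    involves the same variables as \<open>s\<close> and is exactly divisible by
    \<open>m\<close>.\<close>
  have "s + exp_div t m \<in> U \<longleftrightarrow> s \<in> hits V" for s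
    using t[of "exp_scale m s"] m by (simp add: exp_dilate_def exp_div_exp_scale hits_def)
  then show "\<exists>t. \<forall>s. s + t \<in> U \<longleftrightarrow> s \<in> hits V"
    by blast
next
  assume "\<exists>t. \<forall>s. s + t \<in> U \<longleftrightarrow> s \<in> hits V"
  then obtain t where t: "\<And>s. s + t \<in> U \<longleftrightarrow> s \<in> hits V"
    by blast
  \<comment> \<open>The offset \<open>m - 1\<close> makes division round up on \<open>V\<close>:
    \<open>(k + (m - 1)) div m\<close> vanishes only for \<open>k = 0\<close>.\<close>
  define e where "e = Abs_poly_mapping (\<lambda>i. if i \<in> V then m - 1 else 0)"
  have e: "Poly_Mapping.lookup e i = (if i \<in> V then m - 1 else 0)" for i
    by (simp add: e_def)
  have "s + (exp_scale m t + e) \<in> exp_dilate m U \<longleftrightarrow> s \<in> hits V" for s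
  proof -
    have "(k + (m - 1)) div m \<noteq> 0 \<longleftrightarrow> k \<noteq> 0" for k
      using m by (auto simp: div_eq_0_iff)
    then have "exp_div (s + e) m \<in> hits V \<longleftrightarrow> s \<in> hits V"
      by (simp add: hits_def lookup_add e)
    moreover have "exp_div (s + (exp_scale m t + e)) m = exp_div (s + e) m + t"
      using exp_div_exp_scale[OF m, of t "s + e"] by (simp add: add_ac)
    ultimately show ?thesis
      using t by (simp add: exp_dilate_def)
  qed
  then show "\<exists>t. \<forall>s. s + t \<in> exp_dilate m U \<longleftrightarrow> s \<in> hits V"
    by blast
qed

section \<open>Primes containing a square power\<close>

lemma primeideal_superset_exp_dilate_iff:
  fixes P :: "('n::finite, 'k::field) mpoly set"
  assumes U: "up_closed U" and m: "m > 0" and P: "primeideal P mpoly_ring"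
  shows "mspan (exp_dilate m U) \<subseteq> P \<longleftrightarrow> mspan U \<subseteq> P"
proof
  have "exp_dilate m U \<subseteq> U"
  proof
    fix t assume "t \<in> exp_dilate m U"
    then have "exp_div t m \<in> U"
      by (simp add: exp_dilate_def)
    with U show "t \<in> U"
      by (rule up_closed_mono) simp
  qed
  then show "mspan U \<subseteq> P \<Longrightarrow> mspan (exp_dilate m U) \<subseteq> P"
    using mspan_mono by blast
  assume sub: "mspan (exp_dilate m U) \<subseteq> P"
  have "ideal P mpoly_ring"
    using P by (simp add: primeideal_ring_of_type_algebra_iff)
  then show "mspan U \<subseteq> P"
  proof (rule mspan_subset_ideal)
    fix t assume "t \<in> U"
    then have "monomial (exp_scale m t) \<in> P"
      using sub m by (auto simp: exp_dilate_def subset_iff)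
    \<comment> \<open>The \<open>m\<close>-th power of \<open>X^t\<close> is its image under the
      substitution, so it lies in \<open>P\<close>, and primality extracts the root.\<close>
    moreover have "monomial t ^ k = (monomial (exp_scale k t) :: ('n, 'k) mpoly)" for k
    proof (induction k)
      case 0
      have "exp_scale 0 t = 0"
        by (rule poly_mapping_eqI) simp
      then show ?case
        by (simp add: monomial_zero)
    next
      case (Suc k)
      have "exp_scale (Suc k) t = t + exp_scale k t"
        by (rule poly_mapping_eqI) (simp add: lookup_add)
      then show ?case
        by (simp add: Suc monomial_add)
    qed
    ultimately show "monomial t \<in> P"
      using power_mem_primeideal[OF P, of "monomial t" m] by simp
  qed
qed

section \<open>Transfer of the decomposition and of both sets of primes\<close>

theorem theorem3p2:
  fixes I :: "('n::finite, 'k::field) mpoly set"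
    and Q :: "nat \<Rightarrow> ('n, 'k) mpoly set"
    and r :: nat
  assumes "monomial_ideal I"
    and "primary_decomposition mpoly_ring I r Q"
    and "\<forall>i\<in>{1..r}. monomial_ideal (Q i)"
  shows "(\<forall>m\<ge>2. primary_decomposition mpoly_ring
            (square_power I m) r (\<lambda>i. square_power (Q i) m))
    \<and> (\<forall>m\<ge>2. Ass mpoly_ring I = Ass mpoly_ring (square_power I m)
          \<and> Min_primes mpoly_ring I = Min_primes mpoly_ring (square_power I m))"
proof -
  obtain U where U: "up_closed U" "I = mspan U"
    using assms(1) by (rule monomial_ideal_imp_mspan)
  have "\<forall>i\<in>{1..r}. \<exists>W. up_closed W \<and> Q i = mspan W"
    using assms(3) monomial_ideal_imp_mspan by metis
  then obtain W where W: "\<And>i. i \<in> {1..r} \<Longrightarrow> up_closed (W i)" "\<And>i. i \<in> {1..r} \<Longrightarrow> Q i = mspan (W i)"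
    by metis
  have prim: "\<And>i. i \<in> {1..r} \<Longrightarrow> primary_ideal (mspan (W i) :: ('n, 'k) mpoly set) mpoly_ring"
    and Int: "(mspan U :: ('n, 'k) mpoly set) = (\<Inter>i\<in>{1..r}. mspan (W i))"
    using assms(2) U W unfolding primary_decomposition_def by auto
  have dec: "primary_decomposition mpoly_ring (mspan U :: ('n, 'k) mpoly set) r (\<lambda>i. mspan (W i))"
    using prim Int by (simp add: primary_decomposition_def)
  \<comment> \<open>A span determines its exponent set, so the decomposition becomes an intersection
    of sets; for \<open>r = 0\<close> both sides are \<open>UNIV\<close>.\<close>
  have U_eq: "U = (\<Inter>i\<in>{1..r}. W i)"
    using Int by (simp flip: mspan_INT)
  have sq: "primary_decomposition mpoly_ring (square_power I m) r (\<lambda>i. square_power (Q i) m)"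
      "Ass mpoly_ring I = Ass mpoly_ring (square_power I m)"
      "Min_primes mpoly_ring I = Min_primes mpoly_ring (square_power I m)" if "m \<ge> 2" for m
  proof -
    have m: "m > 0"
      using that by simp
    note I_m = square_power_mspan[OF U(1) m, where ?'k = 'k]
    have Q_m: "square_power (Q i) m = mspan (exp_dilate m (W i))" if "i \<in> {1..r}" for i
      using W[OF that] m by (simp add: square_power_mspan)
    have "exp_dilate m U = (\<Inter>i\<in>{1..r}. exp_dilate m (W i))"
      by (auto simp: exp_dilate_def U_eq)
    then have dec_m: "primary_decomposition mpoly_ring (mspan (exp_dilate m U) :: ('n, 'k) mpoly set) r
        (\<lambda>i. mspan (exp_dilate m (W i)))"
      using W(1) m prim
      by (simp add: primary_decomposition_def primary_ideal_mspan_exp_dilate mspan_INT)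
    then show "primary_decomposition mpoly_ring (square_power I m) r (\<lambda>i. square_power (Q i) m)"
      using Q_m by (simp add: primary_decomposition_def U(2) I_m)
    show "Ass mpoly_ring I = Ass mpoly_ring (square_power I m)"
      unfolding U(2) I_m
      using Ass_mspan[OF U(1) dec W(1)]
        Ass_mspan[OF up_closed_exp_dilate[OF U(1)] dec_m up_closed_exp_dilate[OF W(1)]]
      by (simp add: exists_witness_exp_dilate_iff[OF m])
    \<comment> \<open>Minimal primes depend on the ideal only through the set of primes containing
      it.\<close>
    show "Min_primes mpoly_ring I = Min_primes mpoly_ring (square_power I m)"
      unfolding U(2) I_m Min_primes_def
      by (simp add: primeideal_superset_exp_dilate_iff[OF U(1) m] cong: conj_cong)
  qed
  then show ?thesis
    by blast
qed

end
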